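(* Let $n,p$ be positive integers such that $n$ and $n+p$ are relatively prime. For $\mathcal{A}=(x_{\mathcal{A}},y_{\mathcal{A}})\in\mathrm{LD}_{n,p}$, the polynomials $L_{\mathcal{A}} := \mathrm{E}_\gamma^{-1} l_{\mathcal{A}}\in\Pi_{n,p}^{2,L}$ are given by $$L_{\mathcal{A}}(x,y) = w_{\mathcal{A}}\left(K_{n,p}^L(x,y;x_{\mathcal{A}},y_{\mathcal{A}}) - \tfrac12\hat{T}_n(y)\hat{T}_n(y_{\mathcal{A}})\right) = w_{\mathcal{A}}\left(K_{n,p}(x,y;x_{\mathcal{A}},y_{\mathcal{A}}) + \tfrac12\hat{T}_n(y)\hat{T}_n(y_{\mathcal{A}})\right)$$ and they form the fundamental Lagrange polynomials in the space $\Pi_{n,p}^{2,L}$ with respect to the point set $\mathrm{LD}_{n,p}$, i.e. $$L_{\mathcal{A}}(\mathcal{B}) = \delta_{\mathcal{A},\mathcal{B}},\qquad \mathcal{A},\mathcal{B}\in\mathrm{LD}_{n,p}.$$ For any given data values $f_{\mathcal{A}}\in\mathbb{R}$, $\mathcal{A}\in\mathrm{LD}_{n,p}$, the interpolation problem of finding $\mathcal{L}_{n,p}f\in\Pi_{n,p}^{2,L}$ with $\mathcal{L}_{n,p}f(\mathcal{A})=f_{\mathcal{A}}$ for all $\mathcal{A}\in\mathrm{LD}_{n,p}$ has a unique solution in $\Pi_{n,p}^{2,L}$, given by $$\mathcal{L}_{n,p}f(x,y) = \sum_{\mathcal{A}\in\mathrm{LD}_{n,p}} f_{\mathcal{A}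}\,L_{\mathcal{A}}(x,y).$$
   Context: Curve and nodes: $\gamma_{n,p}(t) = (\cos(nt),\cos((n+p)t))$, $t_k := \frac{\pi k}{n(n+p)}$, $\mathrm{LD}_{n,p} := \{\gamma_{n,p}(t_k): k=0,\ldots,n(n+p)\}\subset[-1,1]^2$. For $\mathcal{A}\in\mathrm{LD}_{n,p}$, write $k\in[\mathcal{A}]$ if $\gamma_{n,p}(t_k)=\mathcal{A}$. Weights: $w_{\mathcal{A}} = \frac{1}{2n(n+p)}$ if $\mathcal{A}\in\{\gamma_{n,p}(0),\gamma_{n,p}(\pi)\}$; $w_{\mathcal{A}}=\frac{1}{n(n+p)}$ if $\mathcal{A}$ is any other node on the boundary of $[-1,1]^2$; $w_{\mathcal{A}}=\frac{2}{n(n+p)}$ if $\mathcal{A}$ lies in the interior of $[-1,1]^2$. Polynomial space: $T_i(x)=\cos(i\arccos x)$, $\hat T_0=1$, $\hat T_i=\sqrt2\,T_i$ for $i\ge1$; $\Gamma_{n,p} := \{(i,j)\in\mathbb{N}_0^2: \frac{i}{n+p}+\frac jn<1\}$, $\Gamma_{n,p}^L := \Gamma_{n,p}\cup\{(0,n)\}$; $\Pi_{n,p}^{2,L} := \mathrm{span}_{\mathbb{R}}\{T_i(x)T_j(y): (i,j)\in\Gamma_{n,p}^L\}$. Kernels: $K_{n,p}^L(x,y;x',y') := \sum_{(i,j)\in\Gamma_{n,p}^L}\hat T_i(x)\hat T_i(x')\hat T_j(y)\hat T_j(y')$, and $K_{n,p}$ is the same sum over $\Gamma_{n,p}$. Operator: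 $\mathrm{E}_\gamma f(t) := f(\gamma_{n,p}(t))$, $t\in[0,\pi]$. Restricted to $\Pi_{n,p}^{2,L}$ it is a bijection onto the space $\Pi_{n(n+p)}^{\mathrm{e},L}$ of all $q(t)=\sum_{m=0}^{n(n+p)}a_m\cos(mt)$, $a_m\in\mathbb{R}$, with $q(t_k)=q(t_{k'})$ whenever $\gamma_{n,p}(t_k)=\gamma_{n,p}(t_{k'})$; $\mathrm{E}_\gamma^{-1}$ denotes the inverse of this bijection. Functions $l_{\mathcal{A}}$: write $N=n(n+p)$ and $D_N(t) := 1+2\sum_{k=1}^{N-1}\cos(kt)+\cos(Nt)$. Put $D_N^0(t)=\frac{D_N(t)}{2N}$, $D_N^k(t)=\frac{D_N(t+t_k)+D_N(t-t_k)}{2N}$ for $1\le k\le N-1$, $D_N^N(t)=\frac{D_N(t-\pi)}{2N}$ (these satisfy $D_N^k(t_{k'})=\delta_{k,k'}$ for $0\le k,k'\le N$). Then $l_{\mathcal{A}}(t) := \sum_{0\le k\le N,\ k\in[\mathcal{A}]}D_N^k(t)\in\Pi_{n(n+p)}^{\mathrm{e},L}$. *)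

theory Defs
  imports "HOL-Analysis.Analysis" "HOL-Computational_Algebra.Polynomial"
begin

text \<open>
  The formula \<open>cos (i arccos x)\<close> is meaningful on \<open>[-1, 1]\<close> only; \<open>cheb_T i\<close> is the polynomial
  that it determines. Existence and uniqueness are \<open>ex1_cheb_T\<close> below.
\<close>

definition cheb_T :: "nat \<Rightarrow> real poly" where
  "cheb_T i = (THE P. \<forall>x\<in>{-1..1}. poly P x = cos (real i * arccos x))"

lemma ex_cheb_T_aux:
  "\<exists>P Q. (\<forall>x\<in>{-1..1}. poly P x = cos (real i * arccos x)) \<and>
         (\<forall>x\<in>{-1..1}. poly Q x = cos (real (Suc i) * arccos x))"
proof (induction i)
  case 0
  have "\<forall>x\<in>{-1..1}. poly 1 x = cos (real 0 * arccos x)" by simp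
  moreover have "\<forall>x\<in>{-1..1}. poly [:0, 1:] x = cos (real (Suc 0) * arccos x)"
    by (simp add: cos_arccos)
  ultimately show ?case by blast
next
  case (Suc i)
  then obtain P Q where P: "\<forall>x\<in>{-1..1}. poly P x = cos (real i * arccos x)"
    and Q: "\<forall>x\<in>{-1..1}. poly Q x = cos (real (Suc i) * arccos x)" by blast
  have "poly ([:0, 2:] * Q - P) x = cos (real (Suc (Suc i)) * arccos x)" if "x \<in> {-1..1}" for x
  proof -
    have "cos (real (Suc (Suc i)) * arccos x) + cos (real i * arccos x)
        = 2 * cos (real (Suc i) * arccos x) * cos (arccos x)"
      using cos_add[of "real (Suc i) * arccos x" "arccos x"]
        cos_diff[of "real (Suc i) * arccos x" "arccos x"]
      by (simp add: algebra_simps)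
    moreover have "cos (arccos x) = x" using that by (simp add: cos_arccos)
    ultimately show ?thesis using P Q that by (simp add: eq_diff_eq diff_eq_eq mult_ac)
  qed
  with Q show ?case by blast
qed

lemma ex1_cheb_T: "\<exists>!P :: real poly. \<forall>x\<in>{-1..1}. poly P x = cos (real i * arccos x)"
proof (rule ex_ex1I)
  show "\<exists>P :: real poly. \<forall>x\<in>{-1..1}. poly P x = cos (real i * arccos x)"
    using ex_cheb_T_aux by blast
next
  fix P Q :: "real poly"
  assume P: "\<forall>x\<in>{-1..1}. poly P x = cos (real i * arccos x)"
    and Q: "\<forall>x\<in>{-1..1}. poly Q x = cos (real i * arccos x)"
  have "{-1..1} \<subseteq> {x. poly (P - Q) x = 0}" using P Q by auto
  moreover have "infinite {-1..1::real}" by (simp add: infinite_Icc)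
  ultimately have "infinite {x. poly (P - Q) x = 0}" using finite_subset by blast
  then have "P - Q = 0" using poly_roots_finite by blast
  then show "P = Q" by simp
qed

lemma poly_cheb_T: "x \<in> {-1..1} \<Longrightarrow> poly (cheb_T i) x = cos (real i * arccos x)"
  using theI'[OF ex1_cheb_T[of i]] unfolding cheb_T_def by blast

definition hat_T :: "nat \<Rightarrow> real \<Rightarrow> real" where
  "hat_T i x = (if i = 0 then 1 else sqrt 2 * poly (cheb_T i) x)"

definition curve :: "nat \<Rightarrow> nat \<Rightarrow> real \<Rightarrow> real \<times> real" where
  "curve n p t = (cos (real n * t), cos (real (n + p) * t))"

definition node_time :: "nat \<Rightarrow> nat \<Rightarrow> nat \<Rightarrow> real" where
  "node_time n p k = pi * real k / real (n * (n + p))"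

definition LD :: "nat \<Rightarrow> nat \<Rightarrow> (real \<times> real) set" where
  "LD n p = (\<lambda>k. curve n p (node_time n p k)) ` {0..n * (n + p)}"

definition node_indices :: "nat \<Rightarrow> nat \<Rightarrow> real \<times> real \<Rightarrow> nat set" where
  "node_indices n p A = {k \<in> {0..n * (n + p)}. curve n p (node_time n p k) = A}"

definition weight :: "nat \<Rightarrow> nat \<Rightarrow> real \<times> real \<Rightarrow> real" where
  "weight n p A =
    (if A \<in> {curve n p 0, curve n p pi} then 1 / (2 * real (n * (n + p)))
     else if A \<in> frontier ({-1..1} \<times> {-1..1}) then 1 / real (n * (n + p))
     else 2 / real (n * (n + p)))"

definition index_set :: "nat \<Rightarrow> nat \<Rightarrow> (nat \<times> nat) set" where
  "index_set n p = {(i, j). real i / real (n + p) + real j / real n < 1}"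

definition index_set_L :: "nat \<Rightarrow> nat \<Rightarrow> (nat \<times> nat) set" where
  "index_set_L n p = index_set n p \<union> {(0, n)}"

text \<open>
  The sums over these index sets below rely on the sets being finite, as sums over infinite sets are \<open>0\<close>.
\<close>

lemma finite_index_set:
  assumes "n > 0"
  shows "finite (index_set n p)"
proof (rule finite_subset)
  show "index_set n p \<subseteq> {..n + p} \<times> {..n}"
  proof clarify
    fix i j assume "(i, j) \<in> index_set n p"
    then have *: "real i / real (n + p) + real j / real n < 1" by (simp add: index_set_def)
    have "real i / real (n + p) \<ge> 0" "real j / real n \<ge> 0" by simp_all
    with * have "real i / real (n + p) < 1" "real j / real n < 1" by linarith+
    with assms show "i \<in> {..n + p} \<and> j \<in> {..n}" by (simp add: divide_less_eq)
  qed
qed simp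

lemma finite_index_set_L: "n > 0 \<Longrightarrow> finite (index_set_L n p)"
  by (simp add: index_set_L_def finite_index_set)

text \<open>
  Bivariate polynomials are represented by the functions that they induce on the whole plane.
\<close>

definition poly_space :: "nat \<Rightarrow> nat \<Rightarrow> (real \<times> real \<Rightarrow> real) set" where
  "poly_space n p =
    {P. \<exists>c :: nat \<times> nat \<Rightarrow> real. \<forall>x y.
       P (x, y) = (\<Sum>(i, j)\<in>index_set_L n p. c (i, j) * (poly (cheb_T i) x * poly (cheb_T j) y))}"

definition kernel_on :: "(nat \<times> nat) set \<Rightarrow> real \<Rightarrow> real \<Rightarrow> real \<Rightarrow> real \<Rightarrow> real" where
  "kernel_on I x y x' y' = (\<Sum>(i, j)\<in>I. hat_T i x * hat_T i x' * hat_T j y * hat_T j y')"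

definition kernel :: "nat \<Rightarrow> nat \<Rightarrow> real \<Rightarrow> real \<Rightarrow> real \<Rightarrow> real \<Rightarrow> real" where
  "kernel n p = kernel_on (index_set n p)"

definition kernel_L :: "nat \<Rightarrow> nat \<Rightarrow> real \<Rightarrow> real \<Rightarrow> real \<Rightarrow> real \<Rightarrow> real" where
  "kernel_L n p = kernel_on (index_set_L n p)"

text \<open>Functions on \<open>[0, pi]\<close> are extensional, i.e. \<open>undefined\<close> outside the interval.\<close>

definition E_curve :: "nat \<Rightarrow> nat \<Rightarrow> (real \<times> real \<Rightarrow> real) \<Rightarrow> real \<Rightarrow> real" where
  "E_curve n p f = (\<lambda>t\<in>{0..pi}. f (curve n p t))"

definition trig_space :: "nat \<Rightarrow> nat \<Rightarrow> (real \<Rightarrow> real) set" where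
  "trig_space n p =
    {q. (\<exists>a :: nat \<Rightarrow> real. q = (\<lambda>t\<in>{0..pi}. \<Sum>m=0..n * (n + p). a m * cos (real m * t))) \<and>
        (\<forall>k\<in>{0..n * (n + p)}. \<forall>k'\<in>{0..n * (n + p)}.
           curve n p (node_time n p k) = curve n p (node_time n p k') \<longrightarrow>
           q (node_time n p k) = q (node_time n p k'))}"

text \<open>
  The inverse of the bijection that \<open>E_curve n p\<close> induces from \<open>poly_space n p\<close> onto
  \<open>trig_space n p\<close>; it is \<open>undefined\<close> outside \<open>trig_space n p\<close>.
\<close>

definition E_curve_inv :: "nat \<Rightarrow> nat \<Rightarrow> (real \<Rightarrow> real) \<Rightarrow> (real \<times> real \<Rightarrow> real)" where
  "E_curve_inv n p = (\<lambda>q\<in>trig_space n p. the_inv_into (poly_space n p) (E_curve n p) q)"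

definition dirichlet :: "nat \<Rightarrow> real \<Rightarrow> real" where
  "dirichlet N t = 1 + 2 * (\<Sum>k=1..N - 1. cos (real k * t)) + cos (real N * t)"

definition dirichlet_node :: "nat \<Rightarrow> nat \<Rightarrow> nat \<Rightarrow> real \<Rightarrow> real" where
  "dirichlet_node n p k t =
    (let N = n * (n + p) in
     if k = 0 then dirichlet N t / (2 * real N)
     else if k = N then dirichlet N (t - pi) / (2 * real N)
     else (dirichlet N (t + node_time n p k) + dirichlet N (t - node_time n p k)) / (2 * real N))"

definition lagrange_trig :: "nat \<Rightarrow> nat \<Rightarrow> real \<times> real \<Rightarrow> real \<Rightarrow> real" where
  "lagrange_trig n p A = (\<lambda>t\<in>{0..pi}. \<Sum>k\<in>node_indices n p A. dirichlet_node n p k t)"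

definition lagrange_poly :: "nat \<Rightarrow> nat \<Rightarrow> real \<times> real \<Rightarrow> real \<times> real \<Rightarrow> real" where
  "lagrange_poly n p A = E_curve_inv n p (lagrange_trig n p A)"

definition interpolates ::
  "nat \<Rightarrow> nat \<Rightarrow> (real \<times> real \<Rightarrow> real) \<Rightarrow> (real \<times> real \<Rightarrow> real) \<Rightarrow> bool" where
  "interpolates n p f P \<longleftrightarrow> P \<in> poly_space n p \<and> (\<forall>A\<in>LD n p. P A = f A)"

end

theory Submission imports Defs begin

text \<open>
  Everything rests on the trapezoidal sums of \<open>cos (\<pi> M k / N)\<close> over \<open>0 \<le> k \<le> N\<close>, which vanish
  unless \<open>2N\<close> divides \<open>M\<close>. On the nodes, \<open>T\<^sub>i(x) T\<^sub>j(y)\<close> is unchanged under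
  \<open>(i, j) \<mapsto> (n + p - i, n - j)\<close>, so the kernel over the triangular index set, corrected by
  \<open>T\<^sub>n(y) T\<^sub>n(y')\<close>, is half of a kernel over a full rectangle; the latter factors into
  two one-dimensional kernels, which are delta functions on the grid. The same sums along the curve make the
  products \<open>T\<^sub>i(x) T\<^sub>j(y)\<close> discretely orthogonal, so a polynomial of the space that
  vanishes at the nodes is zero. Finally the explicit polynomial and \<open>l\<^sub>A\<close> both become cosine
  polynomials of degree at most \<open>N\<close> that agree at the \<open>N + 1\<close> times \<open>t\<^sub>k\<close>, hence they are equal.
\<close>

section \<open>Trapezoidal sums of cosines\<close>

text \<open>The Chebyshev recurrence makes \<open>cos (i * a)\<close> a function of
  \<open>cos a\<close>. So \<open>arccos (cos t)\<close> may be replaced by \<open>t\<close> for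
  every real \<open>t\<close>, also outside \<open>[0, pi]\<close>.\<close>

lemma cos_mult_cong:
  fixes a b :: real
  assumes "cos a = cos b"
  shows "cos (real i * a) = cos (real i * b)"
proof (induction i rule: induct_nat_012)
  case (ge2 i)
  have rec: "cos (real (Suc (Suc i)) * x) = 2 * cos x * cos (real (Suc i) * x) - cos (real i * x)"
    for x :: real
    using cos_add[of "real (Suc i) * x" x] cos_diff[of "real (Suc i) * x" x]
    by (simp add: algebra_simps)
  show ?case unfolding rec using ge2 assms by simp
qed (use assms in auto)

lemma poly_cheb_T_cos: "poly (cheb_T i) (cos t) = cos (real i * t)"
  by (subst poly_cheb_T) (auto intro!: cos_mult_cong simp: cos_arccos)

definition trap_weight :: "nat \<Rightarrow> nat \<Rightarrow> real" where
  "trap_weight N k = (if k = 0 \<or> k = N then 1 / 2 else 1)"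

lemma trap_weight_pos: "trap_weight N k > 0"
  by (simp add: trap_weight_def)

lemma sum_trap_weight_dirichlet:
  assumes "N > 0"
  shows "(\<Sum>k=0..N. trap_weight N k * cos (real k * t)) = dirichlet N t / 2"
proof -
  have "{0..N} = insert 0 (insert N {1..N - 1})" using assms by auto
  then have "(\<Sum>k=0..N. trap_weight N k * cos (real k * t)) =
      1 / 2 + (cos (real N * t) / 2 + (\<Sum>k=1..N - 1. trap_weight N k * cos (real k * t)))"
    using assms by (auto simp: trap_weight_def)
  also have "(\<Sum>k=1..N - 1. trap_weight N k * cos (real k * t)) = (\<Sum>k=1..N - 1. cos (real k * t))"
    by (intro sum.cong) (auto simp: trap_weight_def)
  finally show ?thesis by (simp add: dirichlet_def)
qed

text \<open>Multiplication by \<open>sin (t / 2)\<close> makes the sum telescope; without a division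
  the identity also covers the zeros of \<open>sin (t / 2)\<close>.\<close>

lemma dirichlet_closed_form:
  assumes "N > 0"
  shows "sin (t / 2) * dirichlet N t = cos (t / 2) * sin (real N * t)"
  using assms
proof (induction N rule: nat_induct_non_zero)
  case 1
  have "1 + cos t = 2 * cos (t / 2) ^ 2" "sin t = 2 * sin (t / 2) * cos (t / 2)"
    using cos_double_cos[of "t / 2"] sin_double[of "t / 2"] by simp_all
  then show ?case by (simp add: dirichlet_def power2_eq_square)
next
  case (Suc N)
  have "{1..N} = insert N {1..N - 1}" "N \<notin> {1..N - 1}" using Suc by auto
  then have "dirichlet (Suc N) t = dirichlet N t + (cos (real N * t) + cos (real (Suc N) * t))"
    by (simp add: dirichlet_def)
  moreover have "sin (t / 2) * (cos (real N * t) + cos (real (Suc N) * t)) =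
      cos (t / 2) * (sin (real (Suc N) * t) - sin (real N * t))"
  proof -
    define u h where "u = real N * t + t / 2" and "h = t / 2"
    have "real N * t = u - h" "real (Suc N) * t = u + h" "t / 2 = h"
      by (simp_all add: u_def h_def algebra_simps)
    then show ?thesis by (simp only:) (simp add: cos_add cos_diff sin_add sin_diff)
  qed
  ultimately show ?case
    using Suc.IH by (simp add: ring_distribs)
qed

text \<open>Here \<open>sin (N * t)\<close> vanishes, so the closed form forces 0 unless
  \<open>sin (t / 2) = 0\<close>; in that case every cosine is 1.\<close>

lemma dirichlet_at_node:
  assumes "N > 0"
  shows "dirichlet N (pi * of_int M / real N) = (if 2 * int N dvd M then 2 * real N else 0)"
proof (cases "2 * int N dvd M")
  case True
  then obtain c where c: "M = 2 * int N * c" by blast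
  have one: "cos (real k * (pi * of_int M / real N)) = 1" for k
  proof -
    have "real k * (pi * of_int M / real N) = 2 * pi * of_int (int k * c)"
      using assms c by (simp add: field_simps)
    then show ?thesis by (simp only: cos_int_2pin)
  qed
  then have "dirichlet N (pi * of_int M / real N) = 1 + 2 * real (N - 1) + 1"
    unfolding dirichlet_def one by simp
  then have "dirichlet N (pi * of_int M / real N) = 2 * real N" using assms by (simp add: of_nat_diff)
  with True show ?thesis by (simp only: if_True)
next
  case False
  have "sin (pi * of_int M / real N / 2) \<noteq> 0"
  proof
    assume "sin (pi * of_int M / real N / 2) = 0"
    then obtain c where "pi * of_int M / real N / 2 = of_int c * pi"
      by (auto simp: sin_zero_iff_int2)
    then have "real_of_int M = real_of_int (2 * int N * c)"
      using assms by (simp add: field_simps)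
    then have "M = 2 * int N * c" by linarith
    with False show False by simp
  qed
  moreover have "sin (real N * (pi * of_int M / real N)) = 0"
    using assms by (simp add: sin_zero_iff_int2)
  ultimately show ?thesis
    using dirichlet_closed_form[OF assms, of "pi * of_int M / real N"] False by simp
qed

text \<open>Point and frequency enter symmetrically,
  \<open>M * (pi * k / N) = k * (pi * M / N)\<close>, so the sum over points is a Dirichlet kernel
  at a single node.\<close>

lemma sum_trap_weight_cos:
  assumes "N > 0"
  shows "(\<Sum>k=0..N. trap_weight N k * cos (of_int M * (pi * real k / real N))) =
    (if 2 * int N dvd M then real N else 0)"
proof -
  have "(\<Sum>k=0..N. trap_weight N k * cos (of_int M * (pi * real k / real N))) =
      (\<Sum>k=0..N. trap_weight N k * cos (real k * (pi * of_int M / real N)))"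
    by (simp add: mult_ac)
  also have "\<dots> = (if 2 * int N dvd M then real N else 0)"
    unfolding sum_trap_weight_dirichlet[OF assms] dirichlet_at_node[OF assms] by simp
  finally show ?thesis .
qed

lemma sum_trap_weight_cos_cos:
  assumes "N > 0"
  shows "(\<Sum>k=0..N. trap_weight N k * (cos (of_int a * (pi * real k / real N))
             * cos (of_int b * (pi * real k / real N)))) =
    ((if 2 * int N dvd a + b then real N else 0) + (if 2 * int N dvd a - b then real N else 0)) / 2"
    (is "?L = _")
proof -
  have "?L = (\<Sum>k=0..N. trap_weight N k * cos (of_int (a + b) * (pi * real k / real N)) / 2
      + trap_weight N k * cos (of_int (a - b) * (pi * real k / real N)) / 2)"
    by (intro sum.cong refl) (simp add: cos_times_cos ring_distribs diff_divide_distrib add_divide_distrib)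
  also have "\<dots> = (\<Sum>k=0..N. trap_weight N k * cos (of_int (a + b) * (pi * real k / real N))) / 2
      + (\<Sum>k=0..N. trap_weight N k * cos (of_int (a - b) * (pi * real k / real N))) / 2"
    by (simp only: sum.distrib sum_divide_distrib)
  finally show ?thesis unfolding sum_trap_weight_cos[OF assms] by (simp add: add_divide_distrib)
qed

section \<open>Discrete orthogonality along the curve\<close>

text \<open>Cosine is even, so the sign of \<open>a\<close> can stay fixed. The grouping keeps the
  frequencies in x (\<open>a\<close>, \<open>c\<close>) apart from those in y (\<open>b\<close>,
  \<open>d\<close>).\<close>

lemma cos_times_cos_4:
  fixes a b c d :: real
  shows "cos a * cos b * (cos c * cos d) =
    (\<Sum>(s, t, u)\<in>{1, -1} \<times> {1, -1} \<times> {1, -1}. cos (a + s * c + (t * b + u * d))) / 8"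
  by (simp add: sum.cartesian_product[symmetric] cos_add cos_diff sin_add sin_diff) (simp add: algebra_simps)

text \<open>
  Reducing modulo \<open>m\<close> and modulo \<open>n\<close> shows that the frequency is \<open>m n (a' + b')\<close>, where \<open>a' + b'\<close> is even and, by the
  degree bound, \<open>\<bar>a'\<bar> + \<bar>b'\<bar> < 2\<close>.
\<close>

lemma lissajous_frequency_eq_0:
  fixes n m i j i' j' :: nat and s t u :: int
  assumes pos: "n > 0" "m > 0" and cop: "coprime n m"
    and less: "(i + i') * n + (j + j') * m < 2 * (n * m)"
    and sgn: "s \<in> {1, -1}" "t \<in> {1, -1}" "u \<in> {1, -1}"
    and dvd: "2 * int (n * m) dvd (int i + s * int i') * int n + (t * int j + u * int j') * int m"
  shows "i = i' \<and> j = j'"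
proof -
  define a b where "a = int i + s * int i'" and "b = t * int j + u * int j'"
  have ab: "2 * (int n * int m) dvd a * int n + b * int m" using dvd by (simp add: a_def b_def)
  have "int m dvd a * int n + b * int m" "int n dvd a * int n + b * int m"
    using ab by (meson dvd_trans dvd_triv_left dvd_triv_right)+
  then have "int m dvd a * int n" "int n dvd b * int m"
    by (simp_all add: dvd_add_left_iff dvd_add_right_iff)
  then have "int m dvd a" "int n dvd b"
    using cop by (simp_all add: coprime_dvd_mult_left_iff coprime_commute)
  then obtain a' b' where a': "a = int m * a'" and b': "b = int n * b'" by (auto elim!: dvdE)
  have "a * int n + b * int m = (int n * int m) * (a' + b')" by (simp add: a' b' algebra_simps)
  with ab have "(int n * int m) * 2 dvd (int n * int m) * (a' + b')" by (simp add: mult_ac)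
  then have even: "even (a' + b')" using pos by (subst (asm) dvd_mult_cancel_left) auto
  have "\<bar>a\<bar> \<le> int (i + i')" "\<bar>b\<bar> \<le> int (j + j')" using sgn by (auto simp: a_def b_def)
  then have "\<bar>a\<bar> * int n + \<bar>b\<bar> * int m \<le> int (i + i') * int n + int (j + j') * int m"
    by (intro add_mono mult_right_mono) auto
  also have "\<dots> < 2 * (int n * int m)" using less by (simp flip: of_nat_mult of_nat_add)
  finally have "(\<bar>a'\<bar> + \<bar>b'\<bar>) * (int n * int m) < 2 * (int n * int m)"
    by (simp add: a' b' abs_mult algebra_simps)
  then have "\<bar>a'\<bar> + \<bar>b'\<bar> < 2" using pos by (simp add: mult_less_cancel_right)
  with even have "a' = 0" "b' = 0" by presburger+
  then have "a = 0" "b = 0" using a' b' by auto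
  then show ?thesis using sgn by (auto simp: a_def b_def)
qed

text \<open>The product splits into eight integer frequencies. By
  \<open>lissajous_frequency_eq_0\<close> none is a multiple of \<open>2 * (n * m)\<close>, so all
  eight trapezoidal sums vanish.\<close>

lemma lissajous_orthogonal:
  fixes n m i j i' j' :: nat
  defines "\<tau> \<equiv> \<lambda>k. pi * real k / real (n * m)"
  assumes pos: "n > 0" "m > 0" and cop: "coprime n m"
    and less: "(i + i') * n + (j + j') * m < 2 * (n * m)"
    and neq: "(i, j) \<noteq> (i', j')"
  shows "(\<Sum>k=0..n * m. trap_weight (n * m) k *
      (cos (real i * (real n * \<tau> k)) * cos (real j * (real m * \<tau> k)) *
       (cos (real i' * (real n * \<tau> k)) * cos (real j' * (real m * \<tau> k))))) = 0" (is "?L = 0")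
proof -
  let ?S = "{1, -1 :: int} \<times> {1, -1 :: int} \<times> {1, -1 :: int}"
  define \<phi> where "\<phi> = (\<lambda>(s, t, u :: int). (int i + s * int i') * int n + (t * int j + u * int j') * int m)"
  have "?L = (\<Sum>k=0..n * m. \<Sum>z\<in>?S. trap_weight (n * m) k * cos (of_int (\<phi> z) * \<tau> k) / 8)"
  proof (intro sum.cong refl)
    fix k
    have "cos (real i * (real n * \<tau> k)) * cos (real j * (real m * \<tau> k)) *
       (cos (real i' * (real n * \<tau> k)) * cos (real j' * (real m * \<tau> k))) =
       (\<Sum>z\<in>?S. cos (of_int (\<phi> z) * \<tau> k)) / 8"
      unfolding cos_times_cos_4
      by (simp add: sum.cartesian_product[symmetric] \<phi>_def) (simp add: algebra_simps)
    then show "trap_weight (n * m) k *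
      (cos (real i * (real n * \<tau> k)) * cos (real j * (real m * \<tau> k)) *
       (cos (real i' * (real n * \<tau> k)) * cos (real j' * (real m * \<tau> k)))) =
      (\<Sum>z\<in>?S. trap_weight (n * m) k * cos (of_int (\<phi> z) * \<tau> k) / 8)"
      by (simp only: sum_distrib_left sum_divide_distrib times_divide_eq_right)
  qed
  also have "\<dots> = (\<Sum>z\<in>?S. (\<Sum>k=0..n * m. trap_weight (n * m) k * cos (of_int (\<phi> z) * \<tau> k)) / 8)"
    by (subst sum.swap) (simp only: sum_divide_distrib)
  also have "\<dots> = 0"
  proof (intro sum.neutral ballI)
    fix z assume z: "z \<in> ?S"
    obtain s t u where stu: "z = (s, t, u)" "s \<in> {1, -1}" "t \<in> {1, -1}" "u \<in> {1, -1}"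
      using z by blast
    have "\<not> 2 * int (n * m) dvd \<phi> z"
    proof
      assume "2 * int (n * m) dvd \<phi> z"
      then have "i = i' \<and> j = j'"
        using lissajous_frequency_eq_0[OF pos cop less stu(2-4)] by (simp only: \<phi>_def stu(1) case_prod_conv)
      with neq show False by simp
    qed
    then show "(\<Sum>k=0..n * m. trap_weight (n * m) k * cos (of_int (\<phi> z) * \<tau> k)) / 8 = 0"
      using sum_trap_weight_cos[of "n * m" "\<phi> z"] pos by (simp add: \<tau>_def)
  qed
  finally show ?thesis .
qed


section \<open>The kernel at the nodes\<close>

lemma hat_T_cos:
  "hat_T i (cos x) * hat_T i (cos x') = (if i = 0 then 1 else 2) * (cos (real i * x) * cos (real i * x'))"
  by (simp add: hat_T_def poly_cheb_T_cos)

lemma in_index_set_iff: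
  assumes "n > 0"
  shows "(i, j) \<in> index_set n p \<longleftrightarrow> i * n + j * (n + p) < n * (n + p)"
proof -
  have "real i / real (n + p) + real j / real n < 1 \<longleftrightarrow>
      real (i * n + j * (n + p)) < real (n * (n + p))"
    using assms unfolding of_nat_add of_nat_mult by (simp add: divide_simps add_pos_nonneg ac_simps del: of_nat_add)
  then show ?thesis by (simp only: index_set_def of_nat_less_iff mem_Collect_eq case_prod_conv)
qed

lemma node_curve:
  assumes "n > 0"
  shows "curve n p (node_time n p k) = (cos (pi * real k / real (n + p)), cos (pi * real k / real n))"
  using assms by (simp add: curve_def node_time_def del: of_nat_add)

text \<open>The argument is \<open>pi * k\<close> minus the unreflected one. The sign depends on
  \<open>k\<close> alone, hence is the same for both coordinates of a node.\<close>

lemma cos_reflect: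
  assumes "i \<le> m" "m > 0"
  shows "cos (real (m - i) * (pi * real k / real m)) = (- 1) ^ k * cos (real i * (pi * real k / real m))"
proof -
  have "real (m - i) * (pi * real k / real m) = pi * real k - real i * (pi * real k / real m)"
    using assms by (simp add: of_nat_diff field_simps)
  then show ?thesis by (simp add: cos_diff mult.commute[of pi])
qed

text \<open>The rectangle consists of the triangle, its reflection and two corners, and reflection
  preserves \<open>F\<close>. The kernel is four times the triangle sum and the correction is four
  times one corner value, whence the factor 2.\<close>

lemma kernel_at_nodes:
  fixes n p k r :: nat
  defines "m \<equiv> n + p"
  assumes "n > 0" "p > 0" and cop: "coprime n (n + p)"
  defines "x \<equiv> pi * real k / real m" and "y \<equiv> pi * real k / real n"
    and "x' \<equiv> pi * real r / real m" and "y' \<equiv> pi * real r / real n"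
  shows "kernel n p (cos x) (cos y) (cos x') (cos y') + 1 / 2 * hat_T n (cos y) * hat_T n (cos y') =
    2 * ((\<Sum>i=0..m. trap_weight m i * (cos (real i * x) * cos (real i * x'))) *
         (\<Sum>j=0..n. trap_weight n j * (cos (real j * y) * cos (real j * y'))))"
proof -
  have m: "m > 0" using \<open>n > 0\<close> by (simp add: m_def)
  define F where "F = (\<lambda>(i, j). trap_weight m i * (cos (real i * x) * cos (real i * x')) *
      (trap_weight n j * (cos (real j * y) * cos (real j * y'))))"
  define \<Gamma> where "\<Gamma> = {(i, j). i * n + j * m < n * m}"
  define \<Gamma>' where "\<Gamma>' = {(i, j) \<in> {0..m} \<times> {0..n}. n * m < i * n + j * m}"
  have \<Gamma>: "index_set n p = \<Gamma>" using in_index_set_iff[OF \<open>n > 0\<close>] by (auto simp: \<Gamma>_def m_def)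
  have lt: "i < m \<and> j < n" if "(i, j) \<in> \<Gamma>" for i j
  proof -
    have "i * n + j * m < n * m" using that by (simp add: \<Gamma>_def)
    then have "i * n < m * n" "j * m < n * m"
      using le_less_trans[OF le_add1] le_less_trans[OF le_add2] by (metis mult.commute)+
    then show ?thesis by (simp only: mult_less_cancel2)
  qed
  have fin: "finite \<Gamma>" "finite \<Gamma>'"
    using finite_index_set[OF \<open>n > 0\<close>, of p] by (auto simp: \<Gamma> \<Gamma>'_def intro: finite_subset[of _ "{0..m} \<times> {0..n}"])
  \<comment> \<open>Coprimality leaves only the two corners on the line that separates the
    triangles.\<close>
  have diag: "(i, j) \<in> {(0, n), (m, 0)}" if "i \<le> m" "j \<le> n" "i * n + j * m = n * m" for i j
  proof -
    have "m dvd i * n" using that(3) by (metis dvd_add_left_iff dvd_triv_right)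
    then have "m dvd i" using cop by (simp add: coprime_dvd_mult_left_iff coprime_commute m_def)
    then have "i = 0 \<or> i = m" using \<open>i \<le> m\<close> m by (auto elim!: dvdE)
    then show ?thesis using that(3) m \<open>n > 0\<close> by auto
  qed
  have grid: "{0..m} \<times> {0..n} = (\<Gamma> \<union> \<Gamma>') \<union> {(0, n), (m, 0)}"
  proof (intro set_eqI iffI)
    fix z assume "z \<in> {0..m} \<times> {0..n}"
    then show "z \<in> (\<Gamma> \<union> \<Gamma>') \<union> {(0, n), (m, 0)}"
      using diag[of "fst z" "snd z"] by (cases z) (force simp: \<Gamma>_def \<Gamma>'_def)
  next
    fix z assume "z \<in> (\<Gamma> \<union> \<Gamma>') \<union> {(0, n), (m, 0)}"
    then show "z \<in> {0..m} \<times> {0..n}"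
      using lt[of "fst z" "snd z"] by (cases z) (auto simp: \<Gamma>'_def)
  qed
  have disj: "\<Gamma> \<inter> \<Gamma>' = {}" "(\<Gamma> \<union> \<Gamma>') \<inter> {(0, n), (m, 0)} = {}"
    by (auto simp: \<Gamma>_def \<Gamma>'_def)
  \<comment> \<open>Both coordinates contribute the sign \<open>(-1)^k * (-1)^r\<close>, as they
    share the indices \<open>k\<close> and \<open>r\<close>; the two signs cancel.\<close>
  have reflect: "F (m - i, n - j) = F (i, j)" if "i \<le> m" "j \<le> n" for i j
  proof -
    have "trap_weight m (m - i) = trap_weight m i" "trap_weight n (n - j) = trap_weight n j"
      using that by (auto simp: trap_weight_def)
    moreover have "(- 1 :: real) ^ k * (- 1) ^ k = 1" "(- 1 :: real) ^ r * (- 1) ^ r = 1"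
      by (simp_all flip: power_add)
    ultimately show ?thesis
      unfolding F_def x_def y_def x'_def y'_def case_prod_conv
        cos_reflect[OF that(1) m] cos_reflect[OF that(2) \<open>n > 0\<close>]
      by (simp add: mult_ac)
  qed
  \<comment> \<open>The levels of a point and its reflection add up to \<open>2 * (n * m)\<close>,
    so reflection exchanges the two strict inequalities.\<close>
  have level: "(m - i) * n + (n - j) * m + (i * n + j * m) = 2 * (n * m)" if "i \<le> m" "j \<le> n" for i j
  proof -
    have "(m - i) * n + i * n = n * m" "(n - j) * m + j * m = n * m"
      using that by (simp_all flip: add_mult_distrib)
    then show ?thesis by linarith
  qed
  have "sum F \<Gamma>' = sum F \<Gamma>"
  proof (rule sum.reindex_bij_witness[of _ "\<lambda>(i, j). (m - i, n - j)" "\<lambda>(i, j). (m - i, n - j)"])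
    fix z assume z: "z \<in> \<Gamma>'"
    obtain i j where ij: "z = (i, j)" by (cases z)
    have le: "i \<le> m" "j \<le> n" "n * m < i * n + j * m" using z by (auto simp: \<Gamma>'_def ij)
    show "(\<lambda>(i, j). (m - i, n - j)) z \<in> \<Gamma>" using le level[of i j] by (simp add: ij \<Gamma>_def)
    show "(\<lambda>(i, j). (m - i, n - j)) ((\<lambda>(i, j). (m - i, n - j)) z) = z" using le by (simp add: ij)
    show "F ((\<lambda>(i, j). (m - i, n - j)) z) = F z" using reflect le by (simp add: ij)
  next
    fix z assume z: "z \<in> \<Gamma>"
    obtain i j where ij: "z = (i, j)" by (cases z)
    have le: "i \<le> m" "j \<le> n" "i * n + j * m < n * m"
      using z lt[of i j] by (auto simp: \<Gamma>_def ij)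
    show "(\<lambda>(i, j). (m - i, n - j)) z \<in> \<Gamma>'" using le level[of i j] by (simp add: ij \<Gamma>'_def)
    show "(\<lambda>(i, j). (m - i, n - j)) ((\<lambda>(i, j). (m - i, n - j)) z) = z" using le by (simp add: ij)
  qed
  moreover have "F (m, 0) = F (0, n)" using reflect[of 0 n] by simp
  moreover have "sum F ({0..m} \<times> {0..n}) = (sum F \<Gamma> + sum F \<Gamma>') + (F (0, n) + F (m, 0))"
    unfolding grid using fin disj m by (simp add: sum.union_disjoint)
  ultimately have "sum F ({0..m} \<times> {0..n}) = 2 * sum F \<Gamma> + 2 * F (0, n)" by simp
  moreover have "kernel n p (cos x) (cos y) (cos x') (cos y') = 4 * sum F \<Gamma>"
  proof -
    \<comment> \<open>The upper ends \<open>m\<close> and \<open>n\<close> do not occur in the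
      triangle, so in each coordinate the normalization is twice the trapezoidal weight.\<close>
    have "hat_T i (cos x) * hat_T i (cos x') * hat_T j (cos y) * hat_T j (cos y') = 4 * F (i, j)"
      if "(i, j) \<in> \<Gamma>" for i j
    proof -
      have "hat_T i (cos x) * hat_T i (cos x') * (hat_T j (cos y) * hat_T j (cos y')) = 4 * F (i, j)"
        unfolding hat_T_cos using lt[OF that] by (simp add: F_def trap_weight_def)
      then show ?thesis by (simp add: mult_ac)
    qed
    then show ?thesis
      unfolding kernel_def kernel_on_def \<Gamma> sum_distrib_left by (intro sum.cong) auto
  qed
  moreover have "1 / 2 * hat_T n (cos y) * hat_T n (cos y') = 4 * F (0, n)"
    using hat_T_cos[of n y y'] \<open>n > 0\<close> by (simp add: F_def trap_weight_def)
  moreover have "sum F ({0..m} \<times> {0..n}) =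
      (\<Sum>i=0..m. trap_weight m i * (cos (real i * x) * cos (real i * x'))) *
      (\<Sum>j=0..n. trap_weight n j * (cos (real j * y) * cos (real j * y')))"
    unfolding sum_product sum.cartesian_product F_def ..
  ultimately show ?thesis by linarith
qed

section \<open>Coinciding nodes, boundary nodes and weights\<close>

lemma sum_trap_weight_node:
  assumes "N > 0"
  shows "(\<Sum>i=0..N. trap_weight N i * (cos (real i * (pi * real k / real N)) * cos (real i * (pi * real r / real N)))) =
    ((if 2 * int N dvd int k + int r then real N else 0) + (if 2 * int N dvd int k - int r then real N else 0)) / 2"
  using sum_trap_weight_cos_cos[OF assms, of "int k" "int r"] by (simp add: mult_ac)

text \<open>A difference of cosines is a product of sines. The conditions obtained are those under
  which the sum in \<open>sum_trap_weight_node\<close> is nonzero.\<close>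

lemma cos_node_eq_iff:
  assumes "N > 0"
  shows "cos (pi * real k / real N) = cos (pi * real r / real N) \<longleftrightarrow>
    2 * int N dvd int k + int r \<or> 2 * int N dvd int k - int r"
proof -
  have sin0: "sin (pi * of_int M / real N / 2) = 0 \<longleftrightarrow> 2 * int N dvd M" for M
  proof -
    have "sin (pi * of_int M / real N / 2) = 0 \<longleftrightarrow> (\<exists>c. pi * of_int M / real N / 2 = of_int c * pi)"
      by (simp add: sin_zero_iff_int2)
    also have "\<dots> \<longleftrightarrow> (\<exists>c. real_of_int M = real_of_int (2 * int N * c))"
      using assms by (simp add: field_simps)
    also have "\<dots> \<longleftrightarrow> 2 * int N dvd M" by (simp only: of_int_eq_iff dvd_def)
    finally show ?thesis .
  qed
  have "cos (pi * real k / real N) = cos (pi * real r / real N) \<longleftrightarrow>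
      sin (pi * of_int (int k + int r) / real N / 2) = 0 \<or> sin (pi * of_int (int r - int k) / real N / 2) = 0"
    using cos_diff_cos[of "pi * real k / real N" "pi * real r / real N"]
    by (subst eq_iff_diff_eq_0) (simp add: ring_distribs add_divide_distrib diff_divide_distrib)
  then show ?thesis unfolding sin0 using dvd_diff_commute by blast
qed

lemma abs_cos_node_eq_1_iff:
  assumes "N > 0"
  shows "\<bar>cos (pi * real k / real N)\<bar> = 1 \<longleftrightarrow> N dvd k"
proof -
  have "\<bar>cos u\<bar> = 1 \<longleftrightarrow> sin u = 0" for u :: real
  proof -
    have "\<bar>cos u\<bar> = 1 \<longleftrightarrow> (cos u)\<^sup>2 = 1" by (simp only: abs_square_eq_1)
    also have "\<dots> \<longleftrightarrow> (sin u)\<^sup>2 = 0" unfolding sin_squared_eq by linarith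
    finally show ?thesis by simp
  qed
  then have "\<bar>cos (pi * real k / real N)\<bar> = 1 \<longleftrightarrow> sin (pi * real k / real N) = 0" .
  also have "\<dots> \<longleftrightarrow> (\<exists>c. pi * real k / real N = of_int c * pi)"
    by (simp add: sin_zero_iff_int2)
  also have "\<dots> \<longleftrightarrow> (\<exists>c. real_of_int (int k) = real_of_int (int N * c))"
    using assms by (simp add: field_simps)
  also have "\<dots> \<longleftrightarrow> int N dvd int k" by (simp only: of_int_eq_iff dvd_def)
  finally show ?thesis by simp
qed

lemma frontier_square:
  "(x, y) \<in> frontier ({-1..1::real} \<times> {-1..1::real}) \<longleftrightarrow>
    \<bar>x\<bar> \<le> 1 \<and> \<bar>y\<bar> \<le> 1 \<and> (\<bar>x\<bar> = 1 \<or> \<bar>y\<bar> = 1)"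
  by (auto simp: frontier_def closure_Times interior_Times)

text \<open>Each coordinate of absolute value 1 doubles a one-dimensional diagonal sum; in this form
  the weight halves once per such coordinate, so the factors cancel in
  \<open>lagrange_kernel_node\<close>.\<close>

lemma weight_node:
  assumes "n > 0" "p > 0" and cop: "coprime n (n + p)" and k: "k \<le> n * (n + p)"
  shows "weight n p (curve n p (node_time n p k)) =
    2 / ((if n + p dvd k then 2 else 1) * (if n dvd k then 2 else 1)) / real (n * (n + p))"
proof -
  define A where "A = curve n p (node_time n p k)"
  have pos: "n + p > 0" using assms by simp
  have fst: "\<bar>fst A\<bar> = 1 \<longleftrightarrow> n + p dvd k"
    unfolding A_def node_curve[OF \<open>n > 0\<close>] fst_conv by (rule abs_cos_node_eq_1_iff[OF pos])
  have snd: "\<bar>snd A\<bar> = 1 \<longleftrightarrow> n dvd k"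
    unfolding A_def node_curve[OF \<open>n > 0\<close>] snd_conv by (rule abs_cos_node_eq_1_iff[OF \<open>n > 0\<close>])
  have front: "A \<in> frontier ({-1..1} \<times> {-1..1}) \<longleftrightarrow> n + p dvd k \<or> n dvd k"
    using frontier_square[of "fst A" "snd A"] fst snd by (simp add: A_def node_curve[OF \<open>n > 0\<close>])
  have corner: "A \<in> {curve n p 0, curve n p pi} \<longleftrightarrow> n + p dvd k \<and> n dvd k"
  proof
    assume "A \<in> {curve n p 0, curve n p pi}"
    then have "\<bar>fst A\<bar> = 1 \<and> \<bar>snd A\<bar> = 1" by (auto simp: curve_def simp flip: of_nat_add)
    then show "n + p dvd k \<and> n dvd k" using fst snd by simp
  next
    assume "n + p dvd k \<and> n dvd k"
    \<comment> \<open>Coprimality leaves only \<open>k = 0\<close> and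
      \<open>k = n * (n + p)\<close>, the two ends of the curve.\<close>
    then have "n * (n + p) dvd k" using cop by (simp add: divides_mult)
    then have "k = 0 \<or> k = n * (n + p)" using k \<open>n > 0\<close> by (auto elim!: dvdE)
    then show "A \<in> {curve n p 0, curve n p pi}"
      using \<open>n > 0\<close> by (auto simp: A_def node_time_def)
  qed
  show ?thesis
    unfolding weight_def A_def[symmetric] corner front by auto
qed

text \<open>The explicit candidate, free of the inverse of \<open>E_curve\<close>;
  \<open>lagrange_poly_eq\<close> identifies it with \<open>lagrange_poly\<close>.\<close>

definition lagrange_kernel :: "nat \<Rightarrow> nat \<Rightarrow> real \<times> real \<Rightarrow> real \<times> real \<Rightarrow> real" where
  "lagrange_kernel n p A = (\<lambda>(x, y).
     weight n p A * (kernel n p x y (fst A) (snd A) + 1 / 2 * hat_T n y * hat_T n (snd A)))"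

lemma lagrange_kernel_node:
  assumes "n > 0" "p > 0" "coprime n (n + p)" and A: "A \<in> LD n p" and B: "B \<in> LD n p"
  shows "lagrange_kernel n p A B = (if A = B then 1 else 0)"
proof -
  define m where "m = n + p"
  have m: "m > 0" using assms by (simp add: m_def)
  obtain k where k: "k \<le> n * (n + p)" "A = curve n p (node_time n p k)" using A by (auto simp: LD_def)
  obtain r where r: "B = curve n p (node_time n p r)" using B by (auto simp: LD_def)
  \<comment> \<open>Twice the one-dimensional sum. The index \<open>r\<close> stays a parameter
    because the diagonal case needs the value at \<open>k\<close>.\<close>
  define S where "S = (\<lambda>r N. (if 2 * int N dvd int r + int k then real N else 0) +
      (if 2 * int N dvd int r - int k then real N else 0))"
  have eq: "A = B \<longleftrightarrow> S r m \<noteq> 0 \<and> S r n \<noteq> 0"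
    using m \<open>n > 0\<close> cos_node_eq_iff[OF m, of r k] cos_node_eq_iff[OF \<open>n > 0\<close>, of r k]
    unfolding k r node_curve[OF \<open>n > 0\<close>] S_def by (auto simp: m_def)
  have val: "lagrange_kernel n p A (curve n p (node_time n p r)) = weight n p A * (S r m * S r n / 2)" for r
    using kernel_at_nodes[OF assms(1-3), of r k]
    unfolding lagrange_kernel_def k r node_curve[OF \<open>n > 0\<close>] fst_conv snd_conv case_prod_conv
      sum_trap_weight_node[OF m, unfolded m_def] sum_trap_weight_node[OF \<open>n > 0\<close>]
    by (simp add: S_def m_def)
  show ?thesis
  proof (cases "A = B")
    case True
    have "S k N = (if N dvd k then 2 else 1) * real N" for N
    proof -
      have "2 * int N dvd int k + int k \<longleftrightarrow> N dvd k"
        by (simp flip: mult_2)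
      then show ?thesis by (simp add: S_def)
    qed
    then have "weight n p A * (S k m * S k n / 2) = 1"
      using weight_node[OF assms(1-3) k(1), folded m_def] m \<open>n > 0\<close> by (simp add: k(2))
    then show ?thesis using True val[of k] k(2) by simp
  next
    case False
    then show ?thesis using eq val[of r] r by auto
  qed
qed

section \<open>Cosine polynomials\<close>

text \<open>Unlike in \<open>trig_space\<close>, the functions live on the whole line and obey no
  node conditions, so shifted arguments raise no question of domain.\<close>

definition cos_polys :: "nat \<Rightarrow> (real \<Rightarrow> real) set" where
  "cos_polys N = {q. \<exists>a :: nat \<Rightarrow> real. \<forall>t. q t = (\<Sum>s=0..N. a s * cos (real s * t))}"

lemma cos_polys_cos:
  assumes "s \<le> N"
  shows "(\<lambda>t. cos (real s * t)) \<in> cos_polys N"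
  unfolding cos_polys_def mem_Collect_eq
proof (intro exI allI)
  show "cos (real s * t) = (\<Sum>r=0..N. (if r = s then 1 else 0) * cos (real r * t))" for t
    using assms by (simp add: if_distrib[of "\<lambda>c. c * _"] sum.delta cong: if_cong)
qed

lemma cos_polys_cmult:
  assumes "q \<in> cos_polys N"
  shows "(\<lambda>t. c * q t) \<in> cos_polys N"
proof -
  obtain a where a: "\<And>t. q t = (\<Sum>s=0..N. a s * cos (real s * t))"
    using assms by (auto simp: cos_polys_def)
  show ?thesis unfolding cos_polys_def mem_Collect_eq
    by (rule exI[of _ "\<lambda>s. c * a s"]) (simp add: a sum_distrib_left mult_ac)
qed

lemma cos_polys_add:
  assumes "q \<in> cos_polys N" "r \<in> cos_polys N"
  shows "(\<lambda>t. q t + r t) \<in> cos_polys N"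
proof -
  obtain a b where "\<And>t. q t = (\<Sum>s=0..N. a s * cos (real s * t))"
    "\<And>t. r t = (\<Sum>s=0..N. b s * cos (real s * t))"
    using assms by (auto simp: cos_polys_def)
  then show ?thesis unfolding cos_polys_def mem_Collect_eq
    by (intro exI[of _ "\<lambda>s. a s + b s"]) (simp add: sum.distrib ring_distribs)
qed

lemma cos_polys_sum:
  assumes "\<And>i. i \<in> I \<Longrightarrow> q i \<in> cos_polys N"
  shows "(\<lambda>t. \<Sum>i\<in>I. q i t) \<in> cos_polys N"
  using assms
proof (induction I rule: infinite_finite_induct)
  case (insert i I)
  then show ?case using cos_polys_add[of "q i" N "\<lambda>t. \<Sum>i\<in>I. q i t"] by simp
qed (use cos_polys_cmult[OF cos_polys_cos[of 0 N], of 0] in auto)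

lemma cos_polys_mult_cos:
  fixes u v :: nat
  assumes "u + v \<le> N"
  shows "(\<lambda>t. cos (real u * t) * cos (real v * t)) \<in> cos_polys N"
proof -
  have abs: "cos (real u * t - real v * t) = cos (real (nat \<bar>int u - int v\<bar>) * t)" for t
  proof (cases "u \<ge> v")
    case True
    then show ?thesis by (simp add: left_diff_distrib nat_diff_distrib)
  next
    case False
    then have "cos (real u * t - real v * t) = cos (- (real v * t - real u * t))" by simp
    also have "\<dots> = cos (real v * t - real u * t)" by (rule cos_minus)
    finally show ?thesis using False by (simp add: left_diff_distrib)
  qed
  have "(\<lambda>t. 1 / 2 * cos (real (nat \<bar>int u - int v\<bar>) * t) + 1 / 2 * cos (real (u + v) * t)) \<in> cos_polys N"
    using assms by (intro cos_polys_add cos_polys_cmult cos_polys_cos) auto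
  moreover have "cos (real u * t) * cos (real v * t) =
      1 / 2 * cos (real (nat \<bar>int u - int v\<bar>) * t) + 1 / 2 * cos (real (u + v) * t)" for t
    unfolding cos_times_cos abs by (simp add: ring_distribs)
  ultimately show ?thesis by simp
qed

lemma double_dvd_diff_iff:
  fixes r k N :: nat
  assumes "r \<le> N" "k \<le> N" "N > 0"
  shows "2 * int N dvd int r - int k \<longleftrightarrow> r = k"
proof
  assume *: "2 * int N dvd int r - int k"
  show "r = k"
  proof (rule ccontr)
    assume "r \<noteq> k"
    then have "2 * int N \<le> \<bar>int r - int k\<bar>" using * dvd_imp_le_int[of "int r - int k" "2 * int N"] by simp
    then show False using assms by linarith
  qed
qed simp

text \<open>Modulo \<open>2 * N\<close> the range \<open>0..N\<close> meets its negative only at the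
  ends, which is why the end indices need separate weights.\<close>

lemma double_dvd_add_iff:
  fixes r k N :: nat
  assumes "r \<le> N" "k \<le> N" "N > 0"
  shows "2 * int N dvd int r + int k \<longleftrightarrow> r = k \<and> (k = 0 \<or> k = N)"
proof
  assume *: "2 * int N dvd int r + int k"
  show "r = k \<and> (k = 0 \<or> k = N)"
  proof (cases "r + k = 0")
    case False
    then have "2 * int N \<le> int r + int k" using * by (intro zdvd_imp_le) auto
    then show ?thesis using assms by linarith
  qed simp
qed auto

text \<open>Cosines of frequency at most \<open>N\<close> are orthogonal for the trapezoidal sum
  over \<open>N + 1\<close> points, so the values there determine every coefficient of the
  difference.\<close>

lemma cos_polys_eqI:
  assumes N: "N > 0" and q: "q \<in> cos_polys N" and r: "r \<in> cos_polys N"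
    and eq: "\<And>k. k \<le> N \<Longrightarrow> q (pi * real k / real N) = r (pi * real k / real N)"
  shows "q t = r t"
proof -
  have "(\<lambda>t. q t + (- 1) * r t) \<in> cos_polys N" by (intro cos_polys_add cos_polys_cmult q r)
  then obtain a where a: "\<And>t. q t + (- 1) * r t = (\<Sum>s=0..N. a s * cos (real s * t))"
    by (auto simp: cos_polys_def)
  have "a s' = 0" if s': "s' \<le> N" for s'
  proof -
    define c where "c = (\<lambda>s. \<Sum>k=0..N. trap_weight N k * (cos (of_int (int s) * (pi * real k / real N))
             * cos (of_int (int s') * (pi * real k / real N))))"
    have zero: "(\<Sum>s=0..N. a s * cos (real s * (pi * real k / real N))) = 0" if "k \<le> N" for k
      unfolding a[symmetric] using eq[OF that] by simp
    have "0 = (\<Sum>k=0..N. trap_weight N k * ((\<Sum>s=0..N. a s * cos (real s * (pi * real k / real N)))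
              * cos (real s' * (pi * real k / real N))))"
      using zero by simp
    also have "\<dots> = (\<Sum>k=0..N. \<Sum>s=0..N. a s * (trap_weight N k * (cos (real s * (pi * real k / real N))
              * cos (real s' * (pi * real k / real N)))))"
      by (simp add: sum_distrib_left sum_distrib_right mult_ac)
    also have "\<dots> = (\<Sum>s=0..N. a s * c s)"
      by (subst sum.swap) (simp add: c_def sum_distrib_left)
    also have "\<dots> = (\<Sum>s\<in>{s'}. a s * c s)"
    proof (rule sum.mono_neutral_right)
      show "\<forall>s\<in>{0..N} - {s'}. a s * c s = 0"
      proof
        fix s assume s: "s \<in> {0..N} - {s'}"
        have "\<not> 2 * int N dvd int s + int s'" "\<not> 2 * int N dvd int s - int s'"
          using s s' double_dvd_add_iff[of s N s'] double_dvd_diff_iff[of s N s'] N by auto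
        then show "a s * c s = 0" unfolding c_def sum_trap_weight_cos_cos[OF N] by simp
      qed
    qed (use s' in auto)
    finally have "a s' * c s' = 0" by simp
    \<comment> \<open>The value is \<open>N\<close> if \<open>s'\<close> is 0 or \<open>N\<close>,
      and \<open>N / 2\<close> otherwise.\<close>
    moreover have "c s' > 0" unfolding c_def sum_trap_weight_cos_cos[OF N] using N by simp
    ultimately show ?thesis by simp
  qed
  then have "q t + (- 1) * r t = 0" unfolding a by simp
  then show ?thesis by simp
qed

text \<open>Along the curve the index \<open>(i, j)\<close> gives frequencies up to
  \<open>i * n + j * (n + p)\<close>: below \<open>n * (n + p)\<close> on the triangle, equal to it
  at \<open>(0, n)\<close>.\<close>

lemma poly_space_curve_cos_polys:
  assumes "n > 0" and P: "P \<in> poly_space n p"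
  shows "(\<lambda>t. P (curve n p t)) \<in> cos_polys (n * (n + p))"
proof -
  obtain c where c: "\<And>x y. P (x, y) =
      (\<Sum>(i, j)\<in>index_set_L n p. c (i, j) * (poly (cheb_T i) x * poly (cheb_T j) y))"
    using P by (auto simp: poly_space_def)
  have "P (curve n p t) = (\<Sum>z\<in>index_set_L n p. c z *
      (cos (real (fst z * n) * t) * cos (real (snd z * (n + p)) * t)))" for t
    unfolding curve_def c poly_cheb_T_cos by (intro sum.cong) (auto simp: mult.assoc)
  moreover have "(\<lambda>t. \<Sum>z\<in>index_set_L n p. c z *
      (cos (real (fst z * n) * t) * cos (real (snd z * (n + p)) * t))) \<in> cos_polys (n * (n + p))"
    using in_index_set_iff[OF \<open>n > 0\<close>]
    by (intro cos_polys_sum cos_polys_cmult cos_polys_mult_cos)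
      (auto simp: index_set_L_def less_imp_le)
  ultimately show ?thesis by simp
qed

text \<open>
  The end indices fit the general formula with weight \<open>1 / 2\<close> because \<open>dirichlet N\<close> has period \<open>2 \<pi>\<close>.
\<close>

lemma dirichlet_node_symmetric:
  assumes N: "n * (n + p) > 0" and k: "k \<le> n * (n + p)"
  shows "dirichlet_node n p k t = trap_weight (n * (n + p)) k *
    (dirichlet (n * (n + p)) (t + node_time n p k) + dirichlet (n * (n + p)) (t - node_time n p k)) /
    (2 * real (n * (n + p)))"
proof -
  define N where "N = n * (n + p)"
  have pos: "N > 0" using N by (simp add: N_def)
  have "dirichlet N (t + pi) = dirichlet N (t - pi)"
  proof -
    have "cos (real k * (t + pi)) = cos (real k * (t - pi))" for k
      by (simp add: ring_distribs cos_add cos_diff sin_npi)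
    then show ?thesis unfolding dirichlet_def by simp
  qed
  moreover have "node_time n p N = pi" "node_time n p 0 = 0"
    using pos by (simp_all add: node_time_def N_def)
  ultimately show ?thesis
    using pos unfolding dirichlet_node_def Let_def N_def[symmetric]
    by (auto simp: trap_weight_def)
qed

text \<open>The two shifts are opposite, so the sine terms cancel and only cosines in
  \<open>t\<close> remain.\<close>

lemma dirichlet_node_cos_polys:
  assumes N: "n * (n + p) > 0" and k: "k \<le> n * (n + p)"
  shows "dirichlet_node n p k \<in> cos_polys (n * (n + p))"
proof -
  define N where "N = n * (n + p)"
  define \<tau> where "\<tau> = node_time n p k"
  have pos: "N > 0" using N by (simp add: N_def)
  have "dirichlet_node n p k t = (\<Sum>s=0..N. (trap_weight N k * 2 * trap_weight N s * cos (real s * \<tau>) / real N)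
      * cos (real s * t))" for t
  proof -
    have D: "dirichlet N u = 2 * (\<Sum>s=0..N. trap_weight N s * cos (real s * u))" for u
      using sum_trap_weight_dirichlet[OF pos, of u] by simp
    have "dirichlet N (t + \<tau>) + dirichlet N (t - \<tau>) =
        2 * (\<Sum>s=0..N. trap_weight N s * (cos (real s * (t + \<tau>)) + cos (real s * (t - \<tau>))))"
      unfolding D by (simp add: sum.distrib ring_distribs)
    also have "\<dots> = (\<Sum>s=0..N. 4 * (trap_weight N s * cos (real s * \<tau>)) * cos (real s * t))"
      unfolding sum_distrib_left by (intro sum.cong) (auto simp: ring_distribs cos_add cos_diff)
    finally show ?thesis
      using dirichlet_node_symmetric[OF N k, of t] unfolding N_def[symmetric] \<tau>_def[symmetric]
      by (simp add: sum_distrib_left sum_divide_distrib mult_ac)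
  qed
  then show ?thesis unfolding cos_polys_def N_def[symmetric] mem_Collect_eq
    by (intro exI allI)
qed

text \<open>For \<open>r = k\<close> an interior index satisfies only the condition on the
  difference. An end index satisfies both, and its weight one half compensates.\<close>

lemma dirichlet_node_at_node:
  assumes N: "n * (n + p) > 0" and k: "k \<le> n * (n + p)" and r: "r \<le> n * (n + p)"
  shows "dirichlet_node n p k (node_time n p r) = (if r = k then 1 else 0)"
proof -
  define N where "N = n * (n + p)"
  have pos: "N > 0" and le: "k \<le> N" "r \<le> N" using assms by (simp_all add: N_def)
  have "node_time n p r + node_time n p k = pi * of_int (int r + int k) / real N"
    "node_time n p r - node_time n p k = pi * of_int (int r - int k) / real N"
    unfolding node_time_def N_def[symmetric] using pos by (simp_all add: field_simps)
  then have *: "dirichlet_node n p k (node_time n p r) = trap_weight N k *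
      ((if 2 * int N dvd int r + int k then 2 * real N else 0) +
       (if 2 * int N dvd int r - int k then 2 * real N else 0)) / (2 * real N)"
    using dirichlet_node_symmetric[OF N k, of "node_time n p r"] unfolding N_def[symmetric]
    by (simp only: dirichlet_at_node[OF pos])
  show ?thesis
    unfolding * double_dvd_add_iff[OF le(2,1) pos] double_dvd_diff_iff[OF le(2,1) pos]
    using pos by (simp add: trap_weight_def)
qed

section \<open>The polynomial space and the Lagrange polynomials\<close>

lemma cheb_T_0: "cheb_T 0 = 1"
  unfolding cheb_T_def by (rule the1_equality[OF ex1_cheb_T]) simp

lemma hat_T_eq: "hat_T i x = (if i = 0 then 1 else sqrt 2) * poly (cheb_T i) x"
  by (simp add: hat_T_def cheb_T_0)

lemma poly_space_diff:
  assumes "P \<in> poly_space n p" "Q \<in> poly_space n p"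
  shows "(\<lambda>z. P z - Q z) \<in> poly_space n p"
proof -
  obtain c d where
    "\<And>x y. P (x, y) = (\<Sum>(i, j)\<in>index_set_L n p. c (i, j) * (poly (cheb_T i) x * poly (cheb_T j) y))"
    "\<And>x y. Q (x, y) = (\<Sum>(i, j)\<in>index_set_L n p. d (i, j) * (poly (cheb_T i) x * poly (cheb_T j) y))"
    using assms unfolding poly_space_def by blast
  then show ?thesis unfolding poly_space_def mem_Collect_eq
    by (intro exI[of _ "\<lambda>z. c z - d z"])
      (simp add: case_prod_unfold left_diff_distrib sum_subtractf)
qed

lemma poly_space_linear_combination:
  assumes "\<And>A. A \<in> S \<Longrightarrow> F A \<in> poly_space n p"
  shows "(\<lambda>z. \<Sum>A\<in>S. f A * F A z) \<in> poly_space n p"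
proof -
  have "\<forall>A\<in>S. \<exists>c. \<forall>x y. F A (x, y) =
      (\<Sum>(i, j)\<in>index_set_L n p. c (i, j) * (poly (cheb_T i) x * poly (cheb_T j) y))"
    using assms unfolding poly_space_def by blast
  from bchoice[OF this] obtain c where c: "\<forall>A\<in>S. \<forall>x y. F A (x, y) =
      (\<Sum>(i, j)\<in>index_set_L n p. c A (i, j) * (poly (cheb_T i) x * poly (cheb_T j) y))" ..
  show ?thesis unfolding poly_space_def mem_Collect_eq
  proof (intro exI allI)
    fix x y
    have "(\<Sum>A\<in>S. f A * F A (x, y)) = (\<Sum>A\<in>S. \<Sum>z\<in>index_set_L n p.
        f A * c A z * (poly (cheb_T (fst z)) x * poly (cheb_T (snd z)) y))"
      by (intro sum.cong refl) (simp add: c sum_distrib_left case_prod_unfold mult_ac)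
    also have "\<dots> = (\<Sum>z\<in>index_set_L n p. \<Sum>A\<in>S.
        f A * c A z * (poly (cheb_T (fst z)) x * poly (cheb_T (snd z)) y))"
      by (rule sum.swap)
    also have "\<dots> = (\<Sum>(i, j)\<in>index_set_L n p. (\<Sum>A\<in>S. f A * c A (i, j)) *
        (poly (cheb_T i) x * poly (cheb_T j) y))"
      by (simp add: case_prod_unfold sum_distrib_right)
    finally show "(\<Sum>A\<in>S. f A * F A (x, y)) = (\<Sum>(i, j)\<in>index_set_L n p. (\<lambda>z. \<Sum>A\<in>S. f A * c A z) (i, j) *
        (poly (cheb_T i) x * poly (cheb_T j) y))" .
  qed
qed

text \<open>The index \<open>(0, n)\<close> lies on the excluded line, so it adds exactly one term;
  this reconciles the two formulas of the theorem.\<close>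

lemma kernel_L_eq:
  assumes "n > 0"
  shows "kernel_L n p x y x' y' = kernel n p x y x' y' + hat_T n y * hat_T n y'"
proof -
  have "(0, n) \<notin> index_set n p" using in_index_set_iff[OF assms] by simp
  then show ?thesis
    using finite_index_set[OF assms]
    by (simp add: kernel_L_def kernel_def kernel_on_def index_set_L_def hat_T_def)
qed

lemma lagrange_kernel_poly_space:
  assumes "n > 0"
  shows "lagrange_kernel n p A \<in> poly_space n p"
proof -
  define h where "h = (\<lambda>i::nat. if i = 0 then 1 else sqrt 2)"
  \<comment> \<open>The entry at \<open>(0, n)\<close> is halved on account of the correction term;
    \<open>h\<close> holds the normalizations in the free variables.\<close>
  define c where "c = (\<lambda>(i, j). weight n p A * ((if (i, j) = (0, n) then 1 / 2 else 1) *
      (h i * h j * hat_T i (fst A) * hat_T j (snd A))))"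
  have notin: "(0, n) \<notin> index_set n p" using in_index_set_iff[OF assms] by simp
  have "lagrange_kernel n p A (x, y) =
      (\<Sum>(i, j)\<in>index_set_L n p. c (i, j) * (poly (cheb_T i) x * poly (cheb_T j) y))" for x y
  proof -
    have "(\<Sum>(i, j)\<in>index_set n p. c (i, j) * (poly (cheb_T i) x * poly (cheb_T j) y)) =
        weight n p A * kernel n p x y (fst A) (snd A)"
      unfolding kernel_def kernel_on_def sum_distrib_left using notin
      by (intro sum.cong refl) (auto simp: c_def h_def hat_T_eq)
    then show ?thesis
      using finite_index_set[OF assms] notin
      by (simp add: lagrange_kernel_def index_set_L_def c_def h_def hat_T_eq cheb_T_0 ring_distribs)
  qed
  then show ?thesis unfolding poly_space_def by blast
qed

lemma finite_LD: "finite (LD n p)"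
  by (simp add: LD_def)

text \<open>Orthogonality along the curve isolates each coefficient, so values at the nodes control
  the polynomial on the whole plane.\<close>

lemma poly_space_eq_0:
  assumes "n > 0" "p > 0" "coprime n (n + p)"
    and P: "P \<in> poly_space n p" and vanish: "\<And>A. A \<in> LD n p \<Longrightarrow> P A = 0"
  shows "P z = 0"
proof -
  obtain c where c: "\<And>x y. P (x, y) =
      (\<Sum>(i, j)\<in>index_set_L n p. c (i, j) * (poly (cheb_T i) x * poly (cheb_T j) y))"
    using P by (auto simp: poly_space_def)
  define N where "N = n * (n + p)"
  define \<tau> where "\<tau> = (\<lambda>k. pi * real k / real (n * (n + p)))"
  define g where "g = (\<lambda>z k. cos (real (fst z) * (real n * \<tau> k)) * cos (real (snd z) * (real (n + p) * \<tau> k)))"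
  have Pg: "(\<Sum>z\<in>index_set_L n p. c z * g z k) = 0" if "k \<le> N" for k
  proof -
    have "curve n p (\<tau> k) \<in> LD n p" using that by (auto simp: LD_def \<tau>_def node_time_def N_def)
    then have "P (curve n p (\<tau> k)) = 0" by (rule vanish)
    then show ?thesis
      unfolding curve_def c poly_cheb_T_cos by (simp add: g_def case_prod_unfold)
  qed
  have ortho: "(\<Sum>k=0..N. trap_weight N k * (g z k * g z' k)) = 0"
    if "z \<in> index_set_L n p" "z' \<in> index_set_L n p" "z \<noteq> z'" for z z'
  proof -
    obtain i j i' j' where ij: "z = (i, j)" "z' = (i', j')" by (cases z, cases z')
    \<comment> \<open>Of two distinct indices at most one is \<open>(0, n)\<close>, the only one of
      level \<open>n * (n + p)\<close>, so the bound stays strict.\<close>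
    have "(i + i') * n + (j + j') * (n + p) < 2 * (n * (n + p))"
      using that in_index_set_iff[OF \<open>n > 0\<close>, of i j p] in_index_set_iff[OF \<open>n > 0\<close>, of i' j' p]
      by (auto simp: ij index_set_L_def add_mult_distrib)
    then show ?thesis
      using lissajous_orthogonal[of n "n + p" i i' j j'] assms that(3)
      by (simp add: ij N_def g_def \<tau>_def)
  qed
  have "c z' = 0" if z': "z' \<in> index_set_L n p" for z'
  proof -
    have "0 = (\<Sum>k=0..N. trap_weight N k * ((\<Sum>z\<in>index_set_L n p. c z * g z k) * g z' k))"
      using Pg by simp
    also have "\<dots> = (\<Sum>k=0..N. \<Sum>z\<in>index_set_L n p. c z * (trap_weight N k * (g z k * g z' k)))"
      by (simp add: sum_distrib_left sum_distrib_right mult_ac)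
    also have "\<dots> = (\<Sum>z\<in>index_set_L n p. c z * (\<Sum>k=0..N. trap_weight N k * (g z k * g z' k)))"
      by (subst sum.swap) (simp add: sum_distrib_left)
    also have "\<dots> = (\<Sum>z\<in>{z'}. c z * (\<Sum>k=0..N. trap_weight N k * (g z k * g z' k)))"
      using z' ortho finite_index_set_L[OF \<open>n > 0\<close>] by (intro sum.mono_neutral_right) auto
    finally have "c z' * (\<Sum>k=0..N. trap_weight N k * (g z' k * g z' k)) = 0" by simp
    moreover have "(\<Sum>k=0..N. trap_weight N k * (g z' k * g z' k)) > 0"
    \<comment> \<open>At \<open>k = 0\<close> all cosines are 1, so this one term is
      positive.\<close>
    proof (rule sum_pos2[of _ 0])
      show "0 < trap_weight N 0 * (g z' 0 * g z' 0)" by (simp add: g_def \<tau>_def trap_weight_pos)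
    qed (auto simp: less_imp_le[OF trap_weight_pos])
    ultimately show ?thesis by simp
  qed
  then show ?thesis using c[of "fst z" "snd z"] by (simp add: case_prod_unfold)
qed

lemma poly_space_eqI:
  assumes "n > 0" "p > 0" "coprime n (n + p)"
    and "P \<in> poly_space n p" "Q \<in> poly_space n p" "\<And>A. A \<in> LD n p \<Longrightarrow> P A = Q A"
  shows "P = Q"
proof
  fix z
  show "P z = Q z"
    using poly_space_eq_0[OF assms(1-3) poly_space_diff[OF assms(4,5)], of z] assms(6) by simp
qed

section \<open>The operator \<open>E_curve\<close> and its inverse\<close>

lemma node_time_in_Icc:
  assumes "n > 0" "k \<le> n * (n + p)"
  shows "node_time n p k \<in> {0..pi}"
proof -
  have "real k / real (n * (n + p)) \<le> 1" using assms by (subst divide_le_eq_1_pos) (auto simp del: of_nat_mult)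
  then have "pi * (real k / real (n * (n + p))) \<le> pi * 1" by (intro mult_left_mono) auto
  then show ?thesis by (simp add: node_time_def del: of_nat_mult)
qed

text \<open>The restriction to \<open>[0, pi]\<close> still sees every node, and the values at the
  nodes determine the polynomial.\<close>

lemma inj_on_E_curve:
  assumes "n > 0" "p > 0" "coprime n (n + p)"
  shows "inj_on (E_curve n p) (poly_space n p)"
proof (rule inj_onI)
  fix P Q assume PQ: "P \<in> poly_space n p" "Q \<in> poly_space n p" "E_curve n p P = E_curve n p Q"
  show "P = Q"
  proof (rule poly_space_eqI[OF assms PQ(1,2)])
    fix A assume "A \<in> LD n p"
    then obtain k where k: "k \<le> n * (n + p)" "A = curve n p (node_time n p k)" by (auto simp: LD_def)
    then show "P A = Q A"
      using fun_cong[OF PQ(3), of "node_time n p k"] node_time_in_Icc[OF \<open>n > 0\<close>, of k p]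
      by (simp add: E_curve_def)
  qed
qed

text \<open>Compatibility at coinciding nodes is automatic, because the value depends only on the
  point of the curve.\<close>

lemma E_curve_in_trig_space:
  assumes "n > 0" "P \<in> poly_space n p"
  shows "E_curve n p P \<in> trig_space n p"
proof -
  obtain a where a: "\<And>t. P (curve n p t) = (\<Sum>s=0..n * (n + p). a s * cos (real s * t))"
    using poly_space_curve_cos_polys[OF assms] unfolding cos_polys_def by blast
  have "E_curve n p P = (\<lambda>t\<in>{0..pi}. \<Sum>s=0..n * (n + p). a s * cos (real s * t))"
    unfolding E_curve_def a ..
  moreover have "E_curve n p P (node_time n p k) = P (curve n p (node_time n p k))"
    if "k \<le> n * (n + p)" for k
    using node_time_in_Icc[OF \<open>n > 0\<close> that] by (simp add: E_curve_def)
  ultimately show ?thesis unfolding trig_space_def by auto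
qed

lemma E_curve_lagrange_kernel:
  assumes "n > 0" "p > 0" "coprime n (n + p)" and A: "A \<in> LD n p"
  shows "E_curve n p (lagrange_kernel n p A) = lagrange_trig n p A"
proof -
  define N where "N = n * (n + p)"
  have N: "N > 0" using assms by (simp add: N_def)
  have "lagrange_kernel n p A (curve n p t) = (\<Sum>k\<in>node_indices n p A. dirichlet_node n p k t)" for t
  proof (rule cos_polys_eqI[OF N, where q = "\<lambda>t. lagrange_kernel n p A (curve n p t)"
        and r = "\<lambda>t. \<Sum>k\<in>node_indices n p A. dirichlet_node n p k t"])
    show "(\<lambda>t. lagrange_kernel n p A (curve n p t)) \<in> cos_polys N"
      unfolding N_def by (rule poly_space_curve_cos_polys[OF \<open>n > 0\<close> lagrange_kernel_poly_space[OF \<open>n > 0\<close>]])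
    show "(\<lambda>t. \<Sum>k\<in>node_indices n p A. dirichlet_node n p k t) \<in> cos_polys N"
      using N unfolding N_def by (intro cos_polys_sum dirichlet_node_cos_polys) (auto simp: node_indices_def)
    fix r assume r: "r \<le> N"
    have B: "curve n p (node_time n p r) \<in> LD n p" using r by (simp add: LD_def N_def)
    \<comment> \<open>At most one summand survives, so the value is 1 even if the curve passes
      through \<open>A\<close> at several node times.\<close>
    have "(\<Sum>k\<in>node_indices n p A. dirichlet_node n p k (node_time n p r)) =
        (\<Sum>k\<in>node_indices n p A. if r = k then 1 else 0)"
      using N r dirichlet_node_at_node[of n p] by (intro sum.cong) (auto simp: node_indices_def N_def)
    also have "\<dots> = (if A = curve n p (node_time n p r) then 1 else 0)"
      using r by (auto simp: node_indices_def N_def)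
    also have "\<dots> = lagrange_kernel n p A (curve n p (node_time n p r))"
      using lagrange_kernel_node[OF assms B] by simp
    finally show "lagrange_kernel n p A (curve n p (pi * real r / real N)) =
        (\<Sum>k\<in>node_indices n p A. dirichlet_node n p k (pi * real r / real N))"
      by (simp only: node_time_def N_def)
  qed
  then show ?thesis unfolding E_curve_def lagrange_trig_def by simp
qed

text \<open>Membership in \<open>trig_space\<close> avoids the \<open>undefined\<close> branch of
  \<open>E_curve_inv\<close>; injectivity then makes the inverse return the candidate.\<close>

lemma lagrange_poly_eq:
  assumes "n > 0" "p > 0" "coprime n (n + p)" and A: "A \<in> LD n p"
  shows "lagrange_poly n p A = lagrange_kernel n p A"
proof -
  have P: "lagrange_kernel n p A \<in> poly_space n p" by (rule lagrange_kernel_poly_space[OF \<open>n > 0\<close>])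
  show ?thesis
    unfolding lagrange_poly_def E_curve_inv_def E_curve_lagrange_kernel[OF assms, symmetric]
    using E_curve_in_trig_space[OF \<open>n > 0\<close> P] the_inv_into_f_f[OF inj_on_E_curve[OF assms(1-3)] P]
    by simp
qed

theorem theorem7:
  fixes n p :: nat
  assumes "n > 0" and "p > 0" and "coprime n (n + p)"
  shows "(\<forall>A\<in>LD n p.
            lagrange_poly n p A \<in> poly_space n p \<and>
            (\<forall>x y.
               lagrange_poly n p A (x, y) =
                 weight n p A * (kernel_L n p x y (fst A) (snd A) - 1 / 2 * hat_T n y * hat_T n (snd A)) \<and>
               lagrange_poly n p A (x, y) =
                 weight n p A * (kernel n p x y (fst A) (snd A) + 1 / 2 * hat_T n y * hat_T n (snd A)))) \<and>
         (\<forall>A\<in>LD n p. \<forall>B\<in>LD n p. lagrange_poly n p A B = (if A = B then 1 else 0)) \<and>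
         (\<forall>f :: real \<times> real \<Rightarrow> real.
            (\<exists>!P. interpolates n p f P) \<and>
            (\<forall>P. interpolates n p f P \<longrightarrow>
                 (\<forall>x y. P (x, y) = (\<Sum>A\<in>LD n p. f A * lagrange_poly n p A (x, y)))))"
proof -
  note hyps = assms
  let ?L = "lagrange_poly n p"
  have space: "?L A \<in> poly_space n p" if "A \<in> LD n p" for A
    using lagrange_poly_eq[OF hyps that] lagrange_kernel_poly_space[OF hyps(1)] by simp
  have formula:
    "?L A (x, y) = weight n p A * (kernel_L n p x y (fst A) (snd A) - 1 / 2 * hat_T n y * hat_T n (snd A))"
    "?L A (x, y) = weight n p A * (kernel n p x y (fst A) (snd A) + 1 / 2 * hat_T n y * hat_T n (snd A))"
    if "A \<in> LD n p" for A x y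
    unfolding lagrange_poly_eq[OF hyps that] kernel_L_eq[OF hyps(1)]
    by (simp_all add: lagrange_kernel_def)
  have delta: "?L A B = (if A = B then 1 else 0)" if "A \<in> LD n p" "B \<in> LD n p" for A B
    using lagrange_poly_eq[OF hyps that(1)] lagrange_kernel_node[OF hyps that] by simp
  have interp: "interpolates n p f (\<lambda>z. \<Sum>A\<in>LD n p. f A * ?L A z)" for f
    unfolding interpolates_def
  proof (intro conjI ballI)
    show "(\<lambda>z. \<Sum>A\<in>LD n p. f A * ?L A z) \<in> poly_space n p"
      using space by (rule poly_space_linear_combination)
    fix B assume B: "B \<in> LD n p"
    have "(\<Sum>A\<in>LD n p. f A * ?L A B) = (\<Sum>A\<in>LD n p. if A = B then f A else 0)"
      using delta B by (intro sum.cong) auto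
    then show "(\<Sum>A\<in>LD n p. f A * ?L A B) = f B"
      using B by (simp add: finite_LD)
  qed
  have unique: "P = (\<lambda>z. \<Sum>A\<in>LD n p. f A * ?L A z)" if "interpolates n p f P" for f P
    using interp[of f] that unfolding interpolates_def by (intro poly_space_eqI[OF hyps]) auto
  have "\<exists>!P. interpolates n p f P" for f using interp unique by (rule ex1I)
  moreover have "\<forall>x y. P (x, y) = (\<Sum>A\<in>LD n p. f A * ?L A (x, y))" if "interpolates n p f P" for f P
    using unique[OF that] by simp
  ultimately show ?thesis using space formula delta by blast
qed

end
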